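(* For integers $n\ge k\ge 0$, let $\mathcal{P}_b(n,k)$ be the set of grounded partitions in $\mathcal{P}_{2,b}$ of weight $n$ having exactly $k$ odd parts, and let $\overline{\mathcal{PO}}(n,k)$ be the set of overpartitions of $n$ into odd parts having exactly $k$ parts. Then there is a bijection between $\mathcal{P}_b(n,k)$ and $\overline{\mathcal{PO}}(n,k)$; in particular $|\mathcal{P}_b(n,k)|=|\overline{\mathcal{PO}}(n,k)|$.
   Context: Colours are $a,b,c$ (indexed $c_0=a$, $c_1=b$, $c_2=c$). A grounded partition in $\mathcal{P}_{2,b}$ is a finite (possibly empty) sequence $(\lambda_1,\lambda_2,\dots,\lambda_\ell)$ of positive integers, each carrying a colour in $\{a,b,c\}$, such that, setting $\lambda_0=0$ with colour $b$ (the ground), for every $0\le j<\ell$, if $\lambda_j$ has colour $c_p$ and $\lambda_{j+1}$ has colour $c_r$, then $\lambda_{j+1}-\lambda_j=|2-p-r|$. (Thus the required differences are: $a\to a$: 2, $a\to b$: 1, $a\to c$: 0, $b\to a$: 1, $b\to b$: 0, $b\to c$: 1, $c\to a$: 0, $c\to b$: 1, $c\to c$: 2.) Its weight is $\lambda_1+\cdots+\lambda_\ell$, and its number of odd parts is counted with multiplicity. An overpartition is a partition in which the first occurrence of each distinct part size may or may not be overlined (equivalently, a pair consisting of a partition into distinct parts, the overlined parts, and an ordinary partition); its number of parts counts all parts, overlined or not, and its weight is the sum of all parts. *)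

theory Defs
  imports Main "HOL-Library.Multiset"
begin

datatype colour = Col_a | Col_b | Col_c

fun col_index :: "colour \<Rightarrow> int" where
  "col_index Col_a = 0"
| "col_index Col_b = 1"
| "col_index Col_c = 2"

type_synonym coloured_part = "nat \<times> colour"

(* The ground 0_b is not stored in the list: a list ps stands for the sequence
   lambda_1, ..., lambda_l, and lambda_0 = 0_b is prepended only to state the difference
   conditions.  Differences are taken in the integers, so the sequence is weakly increasing. *)
definition grounded_partition_2b :: "coloured_part list \<Rightarrow> bool" where
  "grounded_partition_2b ps \<longleftrightarrow>
     (\<forall>x \<in> set ps. 0 < fst x) \<and>
     (\<forall>j < length ps.
        int (fst (((0, Col_b) # ps) ! Suc j)) - int (fst (((0, Col_b) # ps) ! j)) =
        \<bar>2 - col_index (snd (((0, Col_b) # ps) ! j)) - col_index (snd (((0, Col_b) # ps) ! Suc j))\<bar>)"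

definition coloured_weight :: "coloured_part list \<Rightarrow> nat" where
  "coloured_weight ps = sum_list (map fst ps)"

definition num_odd_parts :: "coloured_part list \<Rightarrow> nat" where
  "num_odd_parts ps = length (filter (\<lambda>x. odd (fst x)) ps)"

definition P_b :: "nat \<Rightarrow> nat \<Rightarrow> coloured_part list set" where
  "P_b n k = {ps. grounded_partition_2b ps \<and> coloured_weight ps = n \<and> num_odd_parts ps = k}"

(* An overpartition is a pair (M, V): M is the multiset of all its parts, overlined or not,
   and V is the set of those part sizes whose first occurrence is overlined. *)
type_synonym overpart = "nat multiset \<times> nat set"

definition overpartition :: "overpart \<Rightarrow> bool" where
  "overpartition p \<longleftrightarrow> (\<forall>x \<in># fst p. 0 < x) \<and> snd p \<subseteq> set_mset (fst p)"

definition PO_bar :: "nat \<Rightarrow> nat \<Rightarrow> overpart set" where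
  "PO_bar n k =
     {p. overpartition p \<and> (\<forall>x \<in># fst p. odd x) \<and> sum_mset (fst p) = n \<and> size (fst p) = k}"

end

theory Submission
  imports Defs "HOL-Computational_Algebra.Formal_Power_Series"
begin

text \<open>
  Every \<open>b\<close>-part is even and every other part is odd, so a grounded partition climbs through levels:
  odd parts $2r-1$ coloured $a$ or $c$, then parts $2r$ coloured $b$. Let $S_r$ and $B_r$ be the
  generating functions, with $x$ marking odd parts and $q$ marking weight, of the grounded partitions
  that end at an odd part $2r-1$, respectively at the even part $2r$. They satisfy
  $S_{r+1} = x q^{2r+1} (S_r + 2 B_r + S_{r+1})$ and $B_{r+1} = q^{2r+2} (S_{r+1} + B_{r+1})$.
  With a prime denoting the substitution of $x q^2$ for $x$, these recurrences imply
  $(1 - x q)(B_r + S_{r+1}) = (1 + x q)(S'_r + B'_r)$, which summed over $r$ gives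
  $(1 - x q) F(x) = (1 + x q) F(x q^2)$ for the total generating function $F$. This is the
  functional equation of $\prod_{i \ge 1} (1 + x q^{2i-1}) / (1 - x q^{2i-1})$. For
  overpartitions it is a case distinction on the parts equal to 1, followed by subtracting 2 from
  all parts when none is 1.
\<close>

unbundle fps_syntax

section \<open>Algebra of the level recurrences\<close>

text \<open>
  The factor $1 - q^{2r}$ needed in the induction step vanishes at $r = 0$, where the initial
  values are used instead.
\<close>

lemma level_recurrence_dilate:
  fixes q x :: "'a::idom" and S B S' B' :: "nat \<Rightarrow> 'a"
  assumes S0: "S 0 = 0" "S' 0 = 0" and B0: "B 0 = 1" "B' 0 = 1"
    and S: "\<And>r. S (Suc r) = x * q ^ (2*r+1) * (S r + 2 * B r + S (Suc r))"
    and B: "\<And>r. B (Suc r) = q ^ (2*r+2) * (S (Suc r) + B (Suc r))"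
    and S': "\<And>r. S' (Suc r) = x * q ^ (2*r+3) * (S' r + 2 * B' r + S' (Suc r))"
    and B': "\<And>r. B' (Suc r) = q ^ (2*r+2) * (S' (Suc r) + B' (Suc r))"
    and nz: "\<And>r. 1 - q ^ (2*r+2) \<noteq> 0" "\<And>r. 1 - x * q ^ (2*r+1) \<noteq> 0"
  shows "(1 - x * q ^ (2*r+1)) * S' r = q ^ (2*r) * (1 - x * q) * S r"
proof (induction r)
  case 0
  show ?case using S0 by simp
next
  case (Suc r)
  define Q y where "Q = q ^ (2*r)" and "y = x * q * Q"
  have p: "q ^ (2*r+1) = q * Q" "q ^ (2*r+3) = q^3 * Q" "q ^ (2 * Suc r) = q^2 * Q"
    "q ^ (2 * Suc r + 1) = q^3 * Q"
    by (simp_all add: Q_def power_add power3_eq_cube power2_eq_square)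
  have 1: "(1 - y) * S (Suc r) = y * (S r + 2 * B r)"
    using S[of r] unfolding p y_def by (simp add: algebra_simps)
  have 2: "(1 - q^2 * y) * S' (Suc r) = q^2 * y * (S' r + 2 * B' r)"
    using S'[of r] unfolding p y_def by (simp add: algebra_simps power2_eq_square power3_eq_cube)
  have goal_eq: "(1 - x * q ^ (2 * Suc r + 1)) * S' (Suc r) = (1 - q^2 * y) * S' (Suc r)"
    unfolding p y_def by (simp add: algebra_simps power2_eq_square power3_eq_cube)
  show ?case
  proof (cases r)
    case 0
    then have "Q = 1" by (simp add: Q_def)
    then have "(1 - q^2 * y) * S' (Suc r) = q^2 * ((1 - y) * S (Suc r))"
      unfolding 1 2 using S0 B0 0 by simp
    then show ?thesis
      unfolding goal_eq p(3) using \<open>Q = 1\<close> by (simp add: y_def mult.assoc)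
  next
    case (Suc s)
    have Q: "Q = q ^ (2*s+2)" by (simp add: Q_def Suc)
    \<comment> \<open>As \<open>r = Suc s\<close>, the recurrence for \<open>B\<close> at
      \<open>s\<close> allows \<open>B r\<close> to be eliminated:
      \<open>(1 - Q) * (S r + 2 * B r) = (1 + Q) * S r\<close>, and likewise for the primed
      series.\<close>
    have b: "(1 - Q) * B r = Q * S r" "(1 - Q) * B' r = Q * S' r"
      using B[of s] B'[of s] unfolding Q[symmetric] Suc[symmetric] by (simp_all add: algebra_simps)
    have IH: "(1 - y) * S' r = Q * (1 - x * q) * S r"
      using Suc.IH unfolding p y_def Q_def[symmetric] by (simp add: algebra_simps)
    have 3: "(1 - Q) * ((1 - y) * S (Suc r)) = y * (1 + Q) * S r"
      unfolding 1 using b(1) by algebra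
    have "(1 - Q) * ((1 - q^2 * y) * S' (Suc r)) = q^2 * y * (1 + Q) * S' r"
      unfolding 2 using b(2) by algebra
    then have "(1 - Q) * (1 - y) * ((1 - q^2 * y) * S' (Suc r)) =
      (1 - Q) * (1 - y) * (q^2 * Q * (1 - x * q) * S (Suc r))"
      using 3 IH by algebra
    moreover have "1 - Q \<noteq> 0" "1 - y \<noteq> 0"
      using nz(1)[of s] nz(2)[of r] unfolding Q[symmetric] p y_def by (simp_all add: mult.assoc)
    ultimately show ?thesis unfolding goal_eq p(3) by simp
  qed
qed

text \<open>Multiplied by \<open>(1 - q ^ (2*r)) * (1 - x * q ^ (2*r+1))\<close>, both sides become
  the same multiple of \<open>S r\<close>: on the left \<open>B r\<close> and
  \<open>S (Suc r)\<close> are eliminated, on the right \<open>B' r\<close> and then, by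
  \<open>level_recurrence_dilate\<close>, \<open>S' r\<close>. For \<open>r = 0\<close> this factor
  is 0 and the initial values settle the claim.\<close>

lemma level_recurrence_shift:
  fixes q x :: "'a::idom" and S B S' B' :: "nat \<Rightarrow> 'a"
  assumes S0: "S 0 = 0" "S' 0 = 0" and B0: "B 0 = 1" "B' 0 = 1"
    and S: "\<And>r. S (Suc r) = x * q ^ (2*r+1) * (S r + 2 * B r + S (Suc r))"
    and B: "\<And>r. B (Suc r) = q ^ (2*r+2) * (S (Suc r) + B (Suc r))"
    and S': "\<And>r. S' (Suc r) = x * q ^ (2*r+3) * (S' r + 2 * B' r + S' (Suc r))"
    and B': "\<And>r. B' (Suc r) = q ^ (2*r+2) * (S' (Suc r) + B' (Suc r))"
    and nz: "\<And>r. 1 - q ^ (2*r+2) \<noteq> 0" "\<And>r. 1 - x * q ^ (2*r+1) \<noteq> 0"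
  shows "(1 - x * q) * (B r + S (Suc r)) = (1 + x * q) * (S' r + B' r)"
proof (cases r)
  case 0
  then show ?thesis using S[of 0] S0 B0 by (simp add: algebra_simps)
next
  case (Suc s)
  define Q y where "Q = q ^ (2*r)" and "y = x * q * Q"
  have p: "q ^ (2*r+1) = q * Q" by (simp add: Q_def)
  have 1: "(1 - y) * S (Suc r) = y * (S r + 2 * B r)"
    using S[of r] unfolding p y_def by (simp add: algebra_simps)
  have Q: "Q = q ^ (2*s+2)" by (simp add: Q_def Suc)
  have b: "(1 - Q) * B r = Q * S r" "(1 - Q) * B' r = Q * S' r"
    using B[of s] B'[of s] unfolding Q[symmetric] Suc[symmetric] by (simp_all add: algebra_simps)
  have d: "(1 - y) * S' r = Q * (1 - x * q) * S r"
    using level_recurrence_dilate[of S S' B B' x q, OF assms, of r]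
    unfolding p y_def Q_def[symmetric] by (simp add: algebra_simps)
  have 3: "(1 - Q) * (1 - y) * (B r + S (Suc r)) = Q * (1 + x * q) * S r"
    using 1 b(1) unfolding y_def by algebra
  have 4: "(1 - Q) * (1 - y) * (S' r + B' r) = Q * (1 - x * q) * S r"
    using d b(2) by algebra
  have "(1 - Q) * (1 - y) * ((1 - x * q) * (B r + S (Suc r))) =
      (1 - Q) * (1 - y) * ((1 + x * q) * (S' r + B' r))"
    using 3 4 by algebra
  moreover have "1 - Q \<noteq> 0" "1 - y \<noteq> 0"
    using nz(1)[of s] nz(2)[of r] unfolding Q[symmetric] p y_def by (simp_all add: mult.assoc)
  ultimately show ?thesis by simp
qed

section \<open>Generating functions in two variables\<close>

text \<open>In \<open>int fps fps\<close> the outer variable is $x$ and the inner one is $q$.\<close>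

definition gf :: "(nat \<Rightarrow> nat \<Rightarrow> nat) \<Rightarrow> int fps fps" where
  "gf f = Abs_fps (\<lambda>k. Abs_fps (\<lambda>n. int (f n k)))"

abbreviation qvar :: "int fps fps" where
  "qvar \<equiv> fps_const fps_X"

text \<open>The substitution of x q^2 for x, written on coefficients; combinatorially it adds 2 to
  every part marked by x.\<close>

definition dilate :: "int fps fps \<Rightarrow> int fps fps" where
  "dilate F = Abs_fps (\<lambda>k. fps_X ^ (2 * k) * fps_nth F k)"

lemma gf_nth [simp]: "gf f $ k $ n = int (f n k)"
  by (simp add: gf_def)

lemma qvar_power_mult_nth: "(qvar ^ i * F) $ k $ n = (if i \<le> n then F $ k $ (n - i) else 0)"
  by (simp add: fps_const_power fps_X_power_mult_nth)

lemma dilate_nth: "dilate F $ k $ n = (if 2 * k \<le> n then F $ k $ (n - 2 * k) else 0)"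
  by (simp add: dilate_def fps_X_power_mult_nth)

lemma dilate_simps:
  "dilate 0 = 0" "dilate 1 = 1" "dilate (F + G) = dilate F + dilate G"
  "dilate (fps_const c * F) = fps_const c * dilate F"
  "dilate (fps_X * F) = fps_X * qvar ^ 2 * dilate F"
proof -
  show "dilate 0 = 0" "dilate 1 = 1" "dilate (F + G) = dilate F + dilate G"
    "dilate (fps_const c * F) = fps_const c * dilate F"
    by (auto simp: dilate_def fps_eq_iff[where 'a = "int fps"] algebra_simps)
  have "dilate (fps_X * F) $ k = (fps_X * (qvar ^ 2 * dilate F)) $ k" for k
    by (cases k) (simp_all add: dilate_def fps_const_power power_add power2_eq_square mult.assoc)
  then show "dilate (fps_X * F) = fps_X * qvar ^ 2 * dilate F"
    by (simp add: fps_eq_iff[where 'a = "int fps"] mult.assoc)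
qed

lemma dilate_sum: "dilate (\<Sum>i\<in>A. F i) = (\<Sum>i\<in>A. dilate (F i))"
  by (induction A rule: infinite_finite_induct) (simp_all add: dilate_simps)

section \<open>Grounded partitions by last part\<close>

definition ground_last :: "coloured_part list \<Rightarrow> coloured_part" where
  "ground_last ps = last ((0, Col_b) # ps)"

lemma ground_last_simps [simp]:
  "ground_last [] = (0, Col_b)" "ground_last (ps @ [x]) = x"
  by (simp_all add: ground_last_def)

definition gap :: "colour \<Rightarrow> colour \<Rightarrow> nat" where
  "gap c d = nat \<bar>2 - col_index c - col_index d\<bar>"

lemma UNIV_colour: "UNIV = {Col_a, Col_b, Col_c}"
  using colour.exhaust by auto

instance colour :: finite
  by standard (simp add: UNIV_colour)

lemma gap_simps [simp]:
  "gap Col_a Col_a = 2" "gap Col_a Col_b = 1" "gap Col_a Col_c = 0"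
  "gap Col_b Col_a = 1" "gap Col_b Col_b = 0" "gap Col_b Col_c = 1"
  "gap Col_c Col_a = 0" "gap Col_c Col_b = 1" "gap Col_c Col_c = 2"
  by (simp_all add: gap_def)

lemma grounded_Nil: "grounded_partition_2b []"
  by (simp add: grounded_partition_2b_def)

text \<open>Each difference condition concerns two neighbours only, so appending a part adds a
  single one; every recursion on the last part rests on this.\<close>

lemma grounded_snoc:
  "grounded_partition_2b (ps @ [x]) \<longleftrightarrow> grounded_partition_2b ps \<and> 0 < fst x \<and>
     fst x = fst (ground_last ps) + gap (snd (ground_last ps)) (snd x)"
proof -
  let ?L = "(0, Col_b) # ps"
  \<comment> \<open>The ground shifts indices by one, so this index hits the last entry, even for
    empty \<open>ps\<close>.\<close>
  have l: "?L ! length ps = ground_last ps"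
    by (simp add: ground_last_def last_conv_nth)
  have "((0, Col_b) # ps @ [x]) ! j = ?L ! j" if "j \<le> length ps" for j
    using that nth_append[of ?L "[x]" j] by simp
  moreover have "(ps @ [x]) ! j = ps ! j" if "j < length ps" for j
    using that by (simp add: nth_append)
  ultimately show ?thesis
    unfolding grounded_partition_2b_def gap_def using l
    by (auto simp: less_Suc_eq all_conj_distrib)
qed

definition ending :: "coloured_part \<Rightarrow> nat \<Rightarrow> nat \<Rightarrow> coloured_part list set" where
  "ending p n k = {ps \<in> P_b n k. ground_last ps = p}"

text \<open>Only the difference condition is recorded; pairs at which no grounded partition ends
  contribute empty \<open>ending\<close> sets.\<close>

definition predecessors :: "coloured_part \<Rightarrow> coloured_part set" where
  "predecessors p = {p'. fst p' + gap (snd p') (snd p) = fst p}"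

lemma finite_predecessors: "finite (predecessors p)"
  by (rule finite_subset[of _ "{..fst p} \<times> UNIV"]) (auto simp: predecessors_def)

lemma length_le_weight:
  "\<forall>x \<in> set ps. 0 < fst x \<Longrightarrow> length ps \<le> coloured_weight ps"
  by (induction ps) (auto simp: coloured_weight_def)

lemma finite_P_b: "finite (P_b n k)"
proof (rule finite_subset)
  show "P_b n k \<subseteq> {ps. set ps \<subseteq> {..n} \<times> UNIV \<and> length ps \<le> n}"
  proof
    fix ps assume ps: "ps \<in> P_b n k"
    then have w: "coloured_weight ps = n" and "\<forall>x \<in> set ps. 0 < fst x"
      by (auto simp: P_b_def grounded_partition_2b_def)
    then have "length ps \<le> n"
      using length_le_weight by blast
    moreover have "fst x \<le> n" if "x \<in> set ps" for x
      using member_le_sum_list[of "fst x" "map fst ps"] that w by (auto simp: coloured_weight_def)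
    ultimately show "ps \<in> {ps. set ps \<subseteq> {..n} \<times> UNIV \<and> length ps \<le> n}"
      by (auto simp: subset_iff)
  qed
  show "finite {ps. set ps \<subseteq> {..n} \<times> (UNIV :: colour set) \<and> length ps \<le> n}"
    by (rule finite_lists_length_le) simp
qed

lemma finite_ending: "finite (ending p n k)"
  using finite_P_b by (simp add: ending_def)

lemma snoc_in_P_b:
  "ps @ [(v, c)] \<in> P_b n k \<longleftrightarrow> 0 < v \<and> v \<le> n \<and> of_bool (odd v) \<le> k \<and>
     ps \<in> P_b (n - v) (k - of_bool (odd v)) \<and> ground_last ps \<in> predecessors (v, c)"
  by (cases "odd v")
    (auto simp: P_b_def grounded_snoc coloured_weight_def num_odd_parts_def predecessors_def)

text \<open>Deleting the last part leaves a partition ending at a predecessor. Positivity of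
  \<open>v\<close> excludes the empty list, which ends at the ground; the guards make the truncated
  subtractions exact.\<close>

lemma ending_step:
  assumes "0 < v"
  shows "ending (v, c) n k =
    (if v \<le> n \<and> of_bool (odd v) \<le> k
     then (\<lambda>ps. ps @ [(v, c)]) ` (\<Union>p\<in>predecessors (v, c). ending p (n - v) (k - of_bool (odd v)))
     else {})" (is "_ = ?R")
proof (rule set_eqI)
  fix ps :: "coloured_part list"
  show "ps \<in> ending (v, c) n k \<longleftrightarrow> ps \<in> ?R"
  proof (cases ps rule: rev_cases)
    case Nil
    with assms show ?thesis by (auto simp: ending_def)
  next
    case (snoc qs x)
    have "ps \<in> ending (v, c) n k \<longleftrightarrow> qs @ [(v, c)] \<in> P_b n k \<and> x = (v, c)"
      by (auto simp: ending_def snoc)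
    also have "\<dots> \<longleftrightarrow> ps \<in> ?R"
      using assms unfolding snoc_in_P_b by (auto simp: ending_def snoc)
    finally show ?thesis .
  qed
qed

lemma card_ending_step:
  assumes "0 < v"
  shows "card (ending (v, c) n k) =
    (if v \<le> n \<and> of_bool (odd v) \<le> k
     then \<Sum>p\<in>predecessors (v, c). card (ending p (n - v) (k - of_bool (odd v)))
     else 0)"
proof -
  have "card ((\<lambda>ps. ps @ [(v, c)]) ` (\<Union>p\<in>predecessors (v, c). ending p m l)) =
      (\<Sum>p\<in>predecessors (v, c). card (ending p m l))" for m l
  proof -
    have "card ((\<lambda>ps. ps @ [(v, c)]) ` (\<Union>p\<in>predecessors (v, c). ending p m l)) =
        card (\<Union>p\<in>predecessors (v, c). ending p m l)"
      by (rule card_image) (simp add: inj_on_def)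
    also have "\<dots> = (\<Sum>p\<in>predecessors (v, c). card (ending p m l))"
      by (rule card_UN_disjoint) (auto simp: finite_predecessors finite_ending, auto simp: ending_def)
    finally show ?thesis .
  qed
  then show ?thesis unfolding ending_step[OF assms] by simp
qed

abbreviation E :: "nat \<Rightarrow> colour \<Rightarrow> int fps fps" where
  "E v c \<equiv> gf (\<lambda>n k. card (ending (v, c) n k))"

text \<open>The last part contributes q^v, and x if it is odd; the guards of
  \<open>card_ending_step\<close> are those of multiplying a power series by a monomial.\<close>

lemma gf_ending_step:
  assumes "0 < v"
  shows "E v c = qvar ^ v * (fps_X ^ of_bool (odd v) * (\<Sum>(w, d)\<in>predecessors (v, c). E w d))"
  by (intro fps_ext)
    (auto simp: qvar_power_mult_nth fps_X_power_mult_nth card_ending_step[OF assms] fps_sum_nth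
      case_prod_beta simp del: power_Suc intro!: sum.cong)


lemma ending_0: "ending (0, c) n k = (if c = Col_b \<and> n = 0 \<and> k = 0 then {[]} else {})"
proof (rule set_eqI)
  fix ps :: "coloured_part list"
  show "ps \<in> ending (0, c) n k \<longleftrightarrow>
      ps \<in> (if c = Col_b \<and> n = 0 \<and> k = 0 then {[]} else {})"
  proof (cases ps rule: rev_cases)
    case Nil
    then show ?thesis
      by (auto simp: ending_def P_b_def grounded_Nil coloured_weight_def num_odd_parts_def)
  next
    case (snoc qs x)
    then show ?thesis
      by (cases x) (auto simp: ending_def snoc_in_P_b)
  qed
qed

lemma gf_ending_0: "E 0 c = (if c = Col_b then 1 else 0)"
  by (auto simp: ending_0 fps_eq_iff)

text \<open>Size 1 stands apart because its predecessor of the same colour would have size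
  -1.\<close>

lemma predecessors_simps:
  "predecessors (1, Col_a) = {(0, Col_b), (1, Col_c)}"
  "predecessors (1, Col_c) = {(0, Col_b), (1, Col_a)}"
  "predecessors (2 * r + 3, Col_a) = {(2 * r + 1, Col_a), (2 * r + 2, Col_b), (2 * r + 3, Col_c)}"
  "predecessors (2 * r + 3, Col_c) = {(2 * r + 1, Col_c), (2 * r + 2, Col_b), (2 * r + 3, Col_a)}"
  "predecessors (2 * r + 2, Col_b) = {(2 * r + 1, Col_a), (2 * r + 1, Col_c), (2 * r + 2, Col_b)}"
  unfolding predecessors_def
  by (rule set_eqI; rename_tac p; case_tac p; rename_tac w d; case_tac d; auto)+

section \<open>Recurrences for the levels\<close>

text \<open>
  At $r = 0$ truncated subtraction gives $2r - 1 = 0$; no grounded partition ends in a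
  non-\<open>b\<close> part 0, so this value is 0 as needed.
\<close>

definition odd_level :: "nat \<Rightarrow> int fps fps" where
  "odd_level r = E (2 * r - 1) Col_a + E (2 * r - 1) Col_c"

definition even_level :: "nat \<Rightarrow> int fps fps" where
  "even_level r = E (2 * r) Col_b"

lemma level_0: "odd_level 0 = 0" "even_level 0 = 1"
  by (simp_all add: odd_level_def even_level_def gf_ending_0)

text \<open>The equations for colours a and c are added. Each has its own colour one odd level
  below, the other colour at the same size, and the b-part between, which is therefore counted
  twice.\<close>

lemma odd_level_Suc:
  "odd_level (Suc r) =
     fps_X * qvar ^ (2*r+1) * (odd_level r + 2 * even_level r + odd_level (Suc r))"
proof (cases r)
  \<comment> \<open>Here the predecessor of the same colour is missing;
    \<open>odd_level 0 = 0\<close> takes its place.\<close>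
  case 0
  have "E 1 Col_a = qvar ^ 1 * (fps_X * (E 0 Col_b + E 1 Col_c))"
    "E 1 Col_c = qvar ^ 1 * (fps_X * (E 0 Col_b + E 1 Col_a))"
    by (subst gf_ending_step; simp add: predecessors_simps[simplified])+
  then have "E 1 Col_a + E 1 Col_c = fps_X * qvar * (2 * E 0 Col_b + (E 1 Col_a + E 1 Col_c))"
    by algebra
  with 0 show ?thesis
    using level_0 by (simp add: odd_level_def even_level_def)
next
  case (Suc s)
  have l: "odd_level (Suc r) = E (2*s+3) Col_a + E (2*s+3) Col_c"
    "odd_level r = E (2*s+1) Col_a + E (2*s+1) Col_c" "even_level r = E (2*s+2) Col_b"
    "2 * r + 1 = 2 * s + 3"
    using Suc by (simp_all add: odd_level_def even_level_def numeral_3_eq_3)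
  have step: "E (2*s+3) Col_a =
      qvar ^ (2*s+3) * (fps_X * (E (2*s+1) Col_a + E (2*s+2) Col_b + E (2*s+3) Col_c))"
    "E (2*s+3) Col_c =
      qvar ^ (2*s+3) * (fps_X * (E (2*s+1) Col_c + E (2*s+2) Col_b + E (2*s+3) Col_a))"
    by (subst gf_ending_step; simp only: predecessors_simps; simp add: add.assoc)+
  show ?thesis
    unfolding l
    by (rule trans[OF arg_cong2[OF step, of "(+)"]]) (simp only: ring_distribs mult_2 ac_simps)
qed

lemma even_level_Suc:
  "even_level (Suc r) = qvar ^ (2*r+2) * (odd_level (Suc r) + even_level (Suc r))"
proof -
  have l: "odd_level (Suc r) = E (2*r+1) Col_a + E (2*r+1) Col_c"
    "even_level (Suc r) = E (2*r+2) Col_b"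
    by (simp_all add: odd_level_def even_level_def)
  have "E (2*r+2) Col_b =
      qvar ^ (2*r+2) * (E (2*r+1) Col_a + E (2*r+1) Col_c + E (2*r+2) Col_b)"
    by (subst gf_ending_step; simp only: predecessors_simps; simp add: add.assoc)
  then show ?thesis
    unfolding l .
qed

text \<open>The abstract identity with \<open>fps_X\<close> as x, \<open>qvar\<close> as q, and
  \<open>dilate\<close> producing the primed series.\<close>

lemma levels_shift:
  "(1 - fps_X * qvar) * (even_level r + odd_level (Suc r)) =
     (1 + fps_X * qvar) * dilate (odd_level r + even_level r)"
proof -
  have "(1 - fps_X * qvar) * (even_level r + odd_level (Suc r)) =
     (1 + fps_X * qvar) * (dilate (odd_level r) + dilate (even_level r))"
  proof (rule level_recurrence_shift)
    fix r
    have pw: "dilate (qvar ^ i * F) = qvar ^ i * dilate F" for i F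
      by (simp add: fps_const_power dilate_simps)
    show "odd_level (Suc r) =
        fps_X * qvar ^ (2*r+1) * (odd_level r + 2 * even_level r + odd_level (Suc r))"
      by (rule odd_level_Suc)
    show "even_level (Suc r) = qvar ^ (2*r+2) * (odd_level (Suc r) + even_level (Suc r))"
      by (rule even_level_Suc)
    \<comment> \<open>The factor q^2 gained by dilating x turns the exponent \<open>2*r+1\<close>
      into \<open>2*r+3\<close>.\<close>
    have qpow: "qvar ^ (2*r+3) = qvar ^ 2 * qvar ^ (2*r+1)"
      unfolding power_add[symmetric] by (rule arg_cong) simp
    show "dilate (odd_level (Suc r)) = fps_X * qvar ^ (2*r+3) *
        (dilate (odd_level r) + 2 * dilate (even_level r) + dilate (odd_level (Suc r)))"
    proof -
      have "dilate (odd_level (Suc r)) = dilate (fps_X *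
          (qvar ^ (2*r+1) * (odd_level r + (even_level r + even_level r) + odd_level (Suc r))))"
        by (subst odd_level_Suc) (simp only: mult_2 mult.assoc)
      also have "\<dots> = fps_X * qvar ^ (2*r+3) *
        (dilate (odd_level r) + 2 * dilate (even_level r) + dilate (odd_level (Suc r)))"
        unfolding dilate_simps(5) pw dilate_simps(3) qpow by (simp only: mult_2 mult.assoc)
      finally show ?thesis .
    qed
    show "dilate (even_level (Suc r)) =
        qvar ^ (2*r+2) * (dilate (odd_level (Suc r)) + dilate (even_level (Suc r)))"
      by (subst even_level_Suc) (simp only: pw dilate_simps)
    \<comment> \<open>A series with constant coefficient 1 in both variables is nonzero, which
      covers both factors to be cancelled.\<close>
    have nz: "F \<noteq> 0" if "F $ 0 $ 0 = 1" for F :: "int fps fps"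
      using that by auto
    have "(1 - qvar ^ (2*r+2)) $ 0 $ 0 = 1"
      using qvar_power_mult_nth[of "2*r+2" 1 0 0] by (simp del: power_Suc)
    then show "1 - qvar ^ (2*r+2) \<noteq> 0"
      by (rule nz)
    have "(1 - fps_X * qvar ^ (2*r+1)) $ 0 $ 0 = 1"
      by (simp add: mult.assoc del: power_Suc)
    then show "1 - fps_X * qvar ^ (2*r+1) \<noteq> 0"
      by (rule nz)
  qed (simp_all add: level_0 dilate_simps)
  then show ?thesis by (simp add: dilate_simps)
qed

section \<open>Summing the levels\<close>

lemma ground_last_le_weight: "ps \<in> P_b n k \<Longrightarrow> fst (ground_last ps) \<le> n"
  using member_le_sum_list[of "fst (last ps)" "map fst ps"]
  by (cases ps rule: rev_cases) (auto simp: P_b_def coloured_weight_def)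

text \<open>A gap is odd exactly when one of its two colours is b and the other is not, and the
  ground is even with colour b.\<close>

lemma odd_ground_last_iff:
  "grounded_partition_2b ps \<Longrightarrow> odd (fst (ground_last ps)) \<longleftrightarrow> snd (ground_last ps) \<noteq> Col_b"
proof (induction ps rule: rev_induct)
  case (snoc x ps)
  then have "fst x = fst (ground_last ps) + gap (snd (ground_last ps)) (snd x)"
    and "odd (fst (ground_last ps)) \<longleftrightarrow> snd (ground_last ps) \<noteq> Col_b"
    by (auto simp only: grounded_snoc)
  then have "odd (fst x) \<longleftrightarrow> snd x \<noteq> Col_b"
    by (cases "snd (ground_last ps)"; cases "snd x") simp_all
  then show ?case by simp
qed simp

lemma level_nth:
  "(odd_level r + even_level r) $ k $ n =
     int (card {ps \<in> P_b n k. (fst (ground_last ps) + 1) div 2 = r})"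
proof -
  have eq: "{ps \<in> P_b n k. (fst (ground_last ps) + 1) div 2 = r} =
    ending (2 * r - 1, Col_a) n k \<union> ending (2 * r - 1, Col_c) n k \<union> ending (2 * r, Col_b) n k"
    (is "?L = ?R")
  proof (intro equalityI subsetI)
    fix ps assume "ps \<in> ?L"
    then have ps: "ps \<in> P_b n k" and r: "(fst (ground_last ps) + 1) div 2 = r"
      by auto
    then have par: "odd (fst (ground_last ps)) \<longleftrightarrow> snd (ground_last ps) \<noteq> Col_b"
      by (intro odd_ground_last_iff) (simp add: P_b_def)
    obtain v c where vc: "ground_last ps = (v, c)" by force
    have "v = (if c = Col_b then 2 * r else 2 * r - 1)"
      using par r unfolding vc by (auto elim!: oddE evenE)
    then show "ps \<in> ?R"
      using ps vc by (cases c) (auto simp: ending_def)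
  next
    fix ps assume R: "ps \<in> ?R"
    have "ending (2 * r - 1, c) n k = {}" if "r = 0" "c \<noteq> Col_b" for c
      using that by (simp add: ending_0)
    with R show "ps \<in> ?L"
      by (cases "r = 0") (auto simp: ending_def)
  qed
  have "card ?R = card (ending (2 * r - 1, Col_a) n k) + card (ending (2 * r - 1, Col_c) n k)
      + card (ending (2 * r, Col_b) n k)"
    by (subst card_Un_disjoint, (simp add: finite_ending; fail)+, force simp: ending_def)+ simp
  then show ?thesis
    unfolding eq by (simp add: odd_level_def even_level_def)
qed

text \<open>A last part is at most \<open>n\<close>, so its level is too; finite sums thus replace
  the infinite sum over levels.\<close>

lemma sum_levels_nth:
  assumes "n \<le> R"
  shows "(\<Sum>r\<le>R. odd_level r + even_level r) $ k $ n = int (card (P_b n k))"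
proof -
  have "P_b n k = (\<Union>r\<le>R. {ps \<in> P_b n k. (fst (ground_last ps) + 1) div 2 = r})"
    using ground_last_le_weight assms by (fastforce)
  then have "card (P_b n k) =
      card (\<Union>r\<le>R. {ps \<in> P_b n k. (fst (ground_last ps) + 1) div 2 = r})"
    by simp
  also have "\<dots> = (\<Sum>r\<le>R. card {ps \<in> P_b n k. (fst (ground_last ps) + 1) div 2 = r})"
    by (rule card_UN_disjoint) (auto simp: finite_P_b)
  finally show ?thesis
    by (simp add: fps_sum_nth level_nth del: fps_add_nth)
qed

text \<open>This is a coefficient of F = x q F + F' + x q F', the functional equation of the total
  generating function; the three summands match in this order.\<close>

lemma card_P_b_Suc:
  "card (P_b n (Suc k)) =
     (if 1 \<le> n then card (P_b (n - 1) k) else 0) +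
     (if 2 * Suc k \<le> n then card (P_b (n - 2 * Suc k) (Suc k)) else 0) +
     (if 1 + 2 * k \<le> n then card (P_b (n - 1 - 2 * k) k) else 0)"
proof -
  \<comment> \<open>Two groupings of the levels: \<open>A\<close> pairs each even level with the
    next odd one, as \<open>levels_shift\<close> requires. They differ only by the extra top level
    in \<open>A\<close>.\<close>
  define D A where "D = (\<Sum>r\<le>n. odd_level r + even_level r)"
    and "A = (\<Sum>r\<le>n. even_level r + odd_level (Suc r))"
  have D: "D $ j $ m = int (card (P_b m j))" if "m \<le> n" for j m
    unfolding D_def using sum_levels_nth that by blast
  have "(\<Sum>r\<le>R. even_level r + odd_level (Suc r)) =
      (\<Sum>r\<le>R. odd_level r + even_level r) + odd_level (Suc R)" for R
    by (induction R) (simp_all add: level_0)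
  then have "A = D + odd_level (Suc n)"
    by (simp add: A_def D_def)
  \<comment> \<open>The extra level ends at a part \<open>2 * n + 1\<close>, too large for weight at
    most \<open>n\<close>.\<close>
  moreover have "odd_level (Suc n) $ j $ m = 0" if "m \<le> n" for j m
  proof -
    have "ending (2 * Suc n - 1, c) m j = {}" for c
      using ground_last_le_weight[of _ m j] that by (force simp: ending_def)
    then show ?thesis by (simp add: odd_level_def)
  qed
  ultimately have A: "A $ j $ m = int (card (P_b m j))" if "m \<le> n" for j m
    using D that by simp
  have qmult: "(fps_X * qvar * F) $ Suc k $ n = (if 1 \<le> n then F $ k $ (n - 1) else 0)" for F
    using qvar_power_mult_nth[of 1 F k n] by (simp add: mult.assoc)
  have "(1 - fps_X * qvar) * A = (1 + fps_X * qvar) * dilate D"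
    by (simp add: A_def D_def dilate_sum sum_distrib_left levels_shift)
  then have "A = fps_X * qvar * A + dilate D + fps_X * qvar * dilate D"
    by (simp add: algebra_simps)
  then have "A $ Suc k $ n = (fps_X * qvar * A) $ Suc k $ n + dilate D $ Suc k $ n
      + (fps_X * qvar * dilate D) $ Suc k $ n"
    by (metis fps_add_nth)
  then show ?thesis
    unfolding qmult dilate_nth by (auto simp: A D split: if_splits)
qed

text \<open>A first part of colour b would be 0 like the ground, so the first part is an odd 1 and
  only the empty partition lacks odd parts.\<close>

lemma card_P_b_0: "card (P_b n 0) = (if n = 0 then 1 else 0)"
proof -
  have "P_b n 0 = (if n = 0 then {[]} else {})"
  proof (rule set_eqI)
    fix ps
    show "ps \<in> P_b n 0 \<longleftrightarrow> ps \<in> (if n = 0 then {[]} else {})"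
    proof (cases ps)
      case Nil
      then show ?thesis
        by (auto simp: P_b_def grounded_Nil coloured_weight_def num_odd_parts_def)
    next
      case (Cons x qs)
      have "odd (fst x)" if g: "grounded_partition_2b ps"
      proof -
        have "0 < fst x" "int (fst x) = \<bar>1 - col_index (snd x)\<bar>"
          using g Cons by (auto simp: grounded_partition_2b_def dest: spec[of _ 0])
        then show ?thesis by (cases "snd x") auto
      qed
      with Cons show ?thesis by (auto simp: P_b_def num_odd_parts_def)
    qed
  qed
  then show ?thesis by simp
qed

section \<open>Overpartitions into odd parts\<close>

definition shift_parts :: "overpart \<Rightarrow> overpart" where
  "shift_parts p = (image_mset (\<lambda>x. x + 2) (fst p), (\<lambda>x. x + 2) ` snd p)"

definition PO_bar_no1 :: "nat \<Rightarrow> nat \<Rightarrow> overpart set" where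
  "PO_bar_no1 n k = {p \<in> PO_bar n k. 1 \<notin># fst p}"

lemma inj_shift_parts: "inj shift_parts"
  by (rule inj_on_inverseI[where g = "\<lambda>p. (image_mset (\<lambda>x. x - 2) (fst p), (\<lambda>x. x - 2) ` snd p)"])
    (simp add: shift_parts_def multiset.map_comp comp_def image_image)

lemma sum_image_mset_add2: "\<Sum>\<^sub># (image_mset (\<lambda>x::nat. x + 2) M) = \<Sum>\<^sub># M + 2 * size M"
  by (induction M) auto

text \<open>The combinatorial counterpart of \<open>dilate\<close>: odd parts other than 1 are at
  least 3, so subtracting 2 keeps them odd and positive, and overlines move along.\<close>

lemma shift_parts_image:
  "shift_parts ` PO_bar n k = PO_bar_no1 (n + 2 * k) k"
proof (intro equalityI subsetI)
  fix p assume "p \<in> shift_parts ` PO_bar n k"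
  then show "p \<in> PO_bar_no1 (n + 2 * k) k"
    by (auto simp: shift_parts_def PO_bar_def PO_bar_no1_def overpartition_def
        sum_image_mset_add2[simplified] intro!: rev_image_eqI dest: subsetD)
next
  fix p assume p: "p \<in> PO_bar_no1 (n + 2 * k) k"
  obtain M V where MV: "p = (M, V)" by force
  define p' where "p' = (image_mset (\<lambda>x. x - 2) M, (\<lambda>x. x - 2) ` V)"
  have ge: "3 \<le> x \<and> odd x" if "x \<in># M" for x
  proof -
    have "odd x" "x \<noteq> 1" using p that by (auto simp: PO_bar_no1_def PO_bar_def MV)
    then show ?thesis by (auto elim!: oddE)
  qed
  have V: "V \<subseteq> set_mset M"
    using p by (auto simp: PO_bar_no1_def PO_bar_def MV overpartition_def)
  have "image_mset (\<lambda>x. x - 2 + 2) M = image_mset id M"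
    using ge by (intro image_mset_cong) fastforce
  moreover have "(\<lambda>x. x - 2 + 2) ` V = id ` V"
    using ge V by (intro image_cong) fastforce+
  ultimately have eq: "shift_parts p' = p"
    by (simp add: shift_parts_def p'_def MV multiset.map_comp comp_def image_image)
  have "\<Sum>\<^sub># (fst p') + 2 * size M = \<Sum>\<^sub># M"
    using eq sum_image_mset_add2[of "fst p'"] by (simp add: shift_parts_def p'_def MV)
  moreover have "overpartition p' \<and> (\<forall>x \<in># fst p'. odd x)"
    using ge V by (fastforce simp: overpartition_def p'_def)
  ultimately have "p' \<in> PO_bar n k"
    using p by (auto simp: PO_bar_no1_def PO_bar_def MV p'_def)
  then show "p \<in> shift_parts ` PO_bar n k"
    using eq by blast
qed

lemma PO_bar_no1_bound:
  assumes "p \<in> PO_bar_no1 n k"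
  shows "2 * k \<le> n"
proof -
  have "2 * size M \<le> \<Sum>\<^sub># M" if "\<And>x. x \<in># M \<Longrightarrow> odd x \<and> x \<noteq> 1" for M :: "nat multiset"
    using that
  proof (induction M)
    case (add x M)
    then have "odd x" "x \<noteq> 1" "2 * size M \<le> \<Sum>\<^sub># M" by auto
    then show ?case by (auto elim!: oddE)
  qed simp
  from this[of "fst p"] assms show ?thesis
    by (auto simp: PO_bar_no1_def PO_bar_def)
qed

lemma card_PO_bar_no1:
  "card (PO_bar_no1 n k) = (if 2 * k \<le> n then card (PO_bar (n - 2 * k) k) else 0)"
proof (cases "2 * k \<le> n")
  case True
  then have "PO_bar_no1 n k = shift_parts ` PO_bar (n - 2 * k) k"
    by (simp add: shift_parts_image)
  then show ?thesis
    using True inj_shift_parts by (simp add: card_image inj_on_subset)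
next
  case False
  then have "PO_bar_no1 n k = {}" using PO_bar_no1_bound by blast
  then show ?thesis using False by simp
qed

lemma finite_PO_bar: "finite (PO_bar n k)"
proof (rule finite_subset)
  show "PO_bar n k \<subseteq> (mset ` {xs. set xs \<subseteq> {..n} \<and> length xs = k}) \<times> Pow {..n}"
  proof
    fix p assume p: "p \<in> PO_bar n k"
    obtain xs where xs: "mset xs = fst p" using ex_mset by blast
    have le: "x \<le> n" if "x \<in># fst p" for x
      using p that member_le_sum_list[of x xs] unfolding xs[symmetric]
      by (auto simp: PO_bar_def sum_mset_sum_list xs[symmetric])
    have "xs \<in> {xs. set xs \<subseteq> {..n} \<and> length xs = k}"
      using p le by (auto simp: PO_bar_def xs[symmetric])
    moreover have "snd p \<subseteq> {..n}"
      using p le by (auto simp: PO_bar_def overpartition_def)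
    ultimately show "p \<in> (mset ` {xs. set xs \<subseteq> {..n} \<and> length xs = k}) \<times> Pow {..n}"
      using xs by (cases p) auto
  qed
  show "finite ((mset ` {xs. set xs \<subseteq> {..n} \<and> length xs = k}) \<times> Pow {..n})"
    by (simp add: finite_lists_length_eq)
qed

definition add_plain1 :: "overpart \<Rightarrow> overpart" where
  "add_plain1 p = (add_mset 1 (fst p), snd p)"

definition add_overlined1 :: "overpart \<Rightarrow> overpart" where
  "add_overlined1 p = (add_mset 1 (fst p), insert 1 (snd p))"

text \<open>If 1 occurs, one copy is removed. Either the overlines remain valid, or that copy was
  the only 1 and was overlined, and no 1 is left.\<close>

lemma PO_bar_Suc_Suc:
  "PO_bar (Suc n) (Suc k) =
     add_plain1 ` PO_bar n k \<union> PO_bar_no1 (Suc n) (Suc k) \<union> add_overlined1 ` PO_bar_no1 n k"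
  (is "?L = ?R")
proof (intro equalityI subsetI)
  fix p assume p: "p \<in> ?L"
  obtain M V where MV: "p = (M, V)" by force
  show "p \<in> ?R"
  proof (cases "1 \<in># M")
    case False
    with p show ?thesis by (simp add: PO_bar_no1_def MV)
  next
    case True
    then obtain N where N: "M = add_mset 1 N" by (metis insert_DiffM)
    show ?thesis
    proof (cases "V \<subseteq> set_mset N")
      case True
      then have "(N, V) \<in> PO_bar n k"
        using p by (auto simp: PO_bar_def overpartition_def MV N)
      then show ?thesis
        by (force simp: add_plain1_def MV N)
    next
      case False
      then have 1: "1 \<in> V" "1 \<notin># N" and "V - {1} \<subseteq> set_mset N"
        using p by (auto simp: PO_bar_def overpartition_def MV N)
      then have "(N, V - {1}) \<in> PO_bar_no1 n k"
        using p by (auto simp: PO_bar_no1_def PO_bar_def overpartition_def MV N)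
      moreover have "add_overlined1 (N, V - {1}) = p"
        using 1 by (auto simp: add_overlined1_def MV N)
      ultimately show ?thesis by blast
    qed
  qed
next
  fix p assume "p \<in> ?R"
  then show "p \<in> ?L"
    by (auto simp: PO_bar_no1_def PO_bar_def overpartition_def add_plain1_def add_overlined1_def)
qed

lemma card_PO_bar_Suc_Suc:
  "card (PO_bar (Suc n) (Suc k)) =
     card (PO_bar n k) + card (PO_bar_no1 (Suc n) (Suc k)) + card (PO_bar_no1 n k)"
proof -
  have fin: "finite (PO_bar_no1 m j)" for m j
    using finite_PO_bar by (simp add: PO_bar_no1_def)
  have V: "snd p \<subseteq> set_mset (fst p)" if "p \<in> PO_bar m j" for p m j
    using that by (auto simp: PO_bar_def overpartition_def)
  have "inj_on add_plain1 (PO_bar n k)"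
    by (auto simp: inj_on_def add_plain1_def prod_eq_iff)
  moreover have "inj_on add_overlined1 (PO_bar_no1 n k)"
  proof (rule inj_onI)
    fix p p' assume "p \<in> PO_bar_no1 n k" "p' \<in> PO_bar_no1 n k"
      and eq: "add_overlined1 p = add_overlined1 p'"
    then have "1 \<notin> snd p" "1 \<notin> snd p'"
      using V[of p n k] V[of p' n k] unfolding PO_bar_no1_def by blast+
    with eq show "p = p'"
      by (auto simp: add_overlined1_def prod_eq_iff dest: insert_ident)
  qed
  moreover have "add_plain1 ` PO_bar n k \<inter> PO_bar_no1 (Suc n) (Suc k) = {}"
    by (auto simp: PO_bar_no1_def add_plain1_def)
  moreover have "(add_plain1 ` PO_bar n k \<union> PO_bar_no1 (Suc n) (Suc k)) \<inter>
      add_overlined1 ` PO_bar_no1 n k = {}"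
    \<comment> \<open>After \<open>add_plain1\<close>, an overlined 1 occurs at least twice; after
      \<open>add_overlined1\<close> on \<open>PO_bar_no1\<close>, it occurs exactly once.\<close>
    using V by (fastforce simp: PO_bar_no1_def add_plain1_def add_overlined1_def)
  ultimately show ?thesis
    unfolding PO_bar_Suc_Suc by (simp add: card_Un_disjoint card_image fin finite_PO_bar)
qed

lemma size_le_sum_mset: "(\<And>x. x \<in># M \<Longrightarrow> 0 < x) \<Longrightarrow> size M \<le> \<Sum>\<^sub># M" for M :: "nat multiset"
proof (induction M)
  case (add x M)
  then have "0 < x" "size M \<le> \<Sum>\<^sub># M" by auto
  then show ?case by simp
qed simp

lemma PO_bar_0_Suc: "PO_bar 0 (Suc k) = {}"
proof (rule equals0I)
  fix p assume "p \<in> PO_bar 0 (Suc k)"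
  then have p: "\<And>x. x \<in># fst p \<Longrightarrow> 0 < x" "size (fst p) = Suc k" "\<Sum>\<^sub># (fst p) = 0"
    unfolding PO_bar_def overpartition_def mem_Collect_eq by blast+
  from size_le_sum_mset[of "fst p", OF p(1)] show False
    unfolding p(2,3) by simp
qed

lemma card_PO_bar_0: "card (PO_bar n 0) = (if n = 0 then 1 else 0)"
proof -
  have "PO_bar n 0 = (if n = 0 then {({#}, {})} else {})"
    by (auto simp: PO_bar_def overpartition_def)
  then show ?thesis by simp
qed

lemma card_PO_bar_Suc:
  "card (PO_bar n (Suc k)) =
     (if 1 \<le> n then card (PO_bar (n - 1) k) else 0) +
     (if 2 * Suc k \<le> n then card (PO_bar (n - 2 * Suc k) (Suc k)) else 0) +
     (if 1 + 2 * k \<le> n then card (PO_bar (n - 1 - 2 * k) k) else 0)"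
  by (cases n) (simp_all add: PO_bar_0_Suc card_PO_bar_Suc_Suc card_PO_bar_no1)

section \<open>Comparison of the counts\<close>

text \<open>Both counts obey the same recursion. Its guards ensure that the weight drops strictly,
  while the number of parts may stay, so the induction is on \<open>n\<close> for all
  \<open>k\<close>.\<close>

lemma card_P_b_eq_card_PO_bar: "card (P_b n k) = card (PO_bar n k)"
proof (induction n arbitrary: k rule: less_induct)
  case (less n)
  show ?case
  proof (cases k)
    case 0
    then show ?thesis by (simp add: card_P_b_0 card_PO_bar_0)
  next
    case (Suc j)
    show ?thesis
      unfolding Suc card_P_b_Suc[of n] card_PO_bar_Suc[of n]
      using less.IH[of "n - 1" j] less.IH[of "n - 2 * Suc j" "Suc j"]
        less.IH[of "n - 1 - 2 * j" j] by auto
  qed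
qed

text \<open>The bijection is not explicit; it comes from equal finite cardinalities.\<close>

theorem theorem1p14:
  fixes n k :: nat
  assumes "k \<le> n"
  shows "(\<exists>f. bij_betw f (P_b n k) (PO_bar n k)) \<and> card (P_b n k) = card (PO_bar n k)"
  using finite_same_card_bij[OF finite_P_b finite_PO_bar] card_P_b_eq_card_PO_bar by blast

end
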